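(* Let $b_n$ ($n\ge1$) be non-negative integers satisfying $0\le b_{n+1}\le b_n$ for all $n\ge1$, and for $p\in[0,1]$ let $T^p_{b_1,b_2,\dots}=\inf\{n\ge1:|S_n^p|\ge b_n\}$. Then, in terms of the likelihood ratio order, $T^p_{b_1,b_2,\dots}$ is increasing in $p\in[0,\frac12]$ and decreasing in $p\in[\frac12,1]$.
   Context: For $p\in[0,1]$, $(S_n^p)_{n\ge 0}$ is the Bernoulli random walk $S_0^p=0$, $S_n^p=X_1^p+\cdots+X_n^p$ ($n\ge 1$), where $X_1^p,X_2^p,\dots$ are i.i.d. with $P(X_n^p=1)=p$ and $P(X_n^p=-1)=1-p$. Convention: $\inf\emptyset=\infty$. Likelihood ratio order: for discrete random variables $T,T'$ with values in $\{1,2,\dots\}$ (almost surely), $T$ is smaller than $T'$ in the likelihood ratio order if the ratio $P(T'=n)/P(T=n)$ is non-decreasing in $n$ over the union of the supports (with $a/0=\infty$ for $a>0$); equivalently, $P(T'=n)\,P(T=m)\le P(T'=m)\,P(T=n)$ for all $n\le m$. "Increasing in $p$ in the likelihood ratio order" means that for $p<p'$ in the interval, $T^p$ is smaller than $T^{p'}$ in this order; "decreasing" is the reverse. *)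

theory Defs
  imports "HOL-Probability.Probability"
begin

definition bernoulli_steps :: "'a measure \<Rightarrow> real \<Rightarrow> (nat \<Rightarrow> 'a \<Rightarrow> int) \<Rightarrow> bool" where
  "bernoulli_steps M p X \<longleftrightarrow>
     prob_space M \<and>
     prob_space.indep_vars M (\<lambda>_. count_space UNIV) X {1..} \<and>
     (\<forall>n\<ge>1. measure M {\<omega> \<in> space M. X n \<omega> = 1} = p \<and>
            measure M {\<omega> \<in> space M. X n \<omega> = - 1} = 1 - p)"

definition walk :: "(nat \<Rightarrow> 'a \<Rightarrow> int) \<Rightarrow> nat \<Rightarrow> 'a \<Rightarrow> int" where
  "walk X n \<omega> = (\<Sum>k=1..n. X k \<omega>)"

text \<open>The infimum is taken in \<^typ>\<open>enat\<close>, where the infimum of the empty set is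
  \<^term>\<open>\<infinity> :: enat\<close>.\<close>

definition exit_time :: "(nat \<Rightarrow> nat) \<Rightarrow> (nat \<Rightarrow> 'a \<Rightarrow> int) \<Rightarrow> 'a \<Rightarrow> enat" where
  "exit_time b X \<omega> = Inf {enat n |n. 1 \<le> n \<and> \<bar>walk X n \<omega>\<bar> \<ge> int (b n)}"

text \<open>The likelihood ratio order is only defined between random variables with values in
  $\{1,2,\dots\}$ almost surely, so this requirement (in particular almost sure finiteness) is part
  of the order.\<close>

definition pos_int_valued :: "'a measure \<Rightarrow> ('a \<Rightarrow> enat) \<Rightarrow> bool" where
  "pos_int_valued M T \<longleftrightarrow>
     T \<in> measurable M (count_space UNIV) \<and> (AE \<omega> in M. 1 \<le> T \<omega> \<and> T \<omega> < \<infinity>)"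

definition prob_at :: "'a measure \<Rightarrow> ('a \<Rightarrow> enat) \<Rightarrow> nat \<Rightarrow> ennreal" where
  "prob_at M T n = emeasure M {\<omega> \<in> space M. T \<omega> = enat n}"

text \<open>Division in \<^typ>\<open>ennreal\<close> satisfies $a/0=\infty$ for $a>0$; the case $0/0$ does not occur
  on the union of the supports.\<close>

definition lr_le :: "'a measure \<Rightarrow> ('a \<Rightarrow> enat) \<Rightarrow> 'b measure \<Rightarrow> ('b \<Rightarrow> enat) \<Rightarrow> bool" where
  "lr_le M T M' T' \<longleftrightarrow>
     pos_int_valued M T \<and> pos_int_valued M' T' \<and>
     mono_on {n. prob_at M T n > 0 \<or> prob_at M' T' n > 0}
       (\<lambda>n. prob_at M' T' n / prob_at M T n)"

definition lr_increasing_on :: "real set \<Rightarrow> (real \<Rightarrow> 'a measure) \<Rightarrow> (real \<Rightarrow> 'a \<Rightarrow> enat) \<Rightarrow> bool" where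
  "lr_increasing_on I M T \<longleftrightarrow>
     (\<forall>p\<in>I. \<forall>p'\<in>I. p < p' \<longrightarrow> lr_le (M p) (T p) (M p') (T p'))"

definition lr_decreasing_on :: "real set \<Rightarrow> (real \<Rightarrow> 'a measure) \<Rightarrow> (real \<Rightarrow> 'a \<Rightarrow> enat) \<Rightarrow> bool" where
  "lr_decreasing_on I M T \<longleftrightarrow>
     (\<forall>p\<in>I. \<forall>p'\<in>I. p < p' \<longrightarrow> lr_le (M p') (T p') (M p) (T p))"

lemma mono_on_ratio_iff_cross_mult:
  fixes f g :: "nat \<Rightarrow> ennreal"
  assumes fin: "\<And>n. f n \<noteq> \<top>" "\<And>n. g n \<noteq> \<top>"
  shows "mono_on {n. f n > 0 \<or> g n > 0} (\<lambda>n. g n / f n) \<longleftrightarrow>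
    (\<forall>n m. n \<le> m \<longrightarrow> g n * f m \<le> g m * f n)"
proof -
  define a b where "a n = enn2real (f n)" and "b n = enn2real (g n)" for n
  have f: "f n = ennreal (a n)" and g: "g n = ennreal (b n)" for n
    using fin by (simp_all add: a_def b_def less_top)
  have nn: "a n \<ge> 0" "b n \<ge> 0" for n
    by (simp_all add: a_def b_def)
  have key: "g n / f n \<le> g m / f m \<longleftrightarrow> g n * f m \<le> g m * f n"
    if "f n > 0 \<or> g n > 0" "f m > 0 \<or> g m > 0" for n m
    using that nn[of n] nn[of m] unfolding f g
    by (cases "a n = 0"; cases "a m = 0")
      (auto simp: divide_ennreal ennreal_mult[symmetric] ennreal_divide_zero
        ennreal_divide_eq_top_iff ennreal_zero_divide field_simps top_unique
        less_le ennreal_eq_0_iff mult_nonneg_nonneg mult_le_0_iff)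
  show ?thesis
  proof
    assume L: "mono_on {n. f n > 0 \<or> g n > 0} (\<lambda>n. g n / f n)"
    show "\<forall>n m. n \<le> m \<longrightarrow> g n * f m \<le> g m * f n"
    proof (intro allI impI)
      fix n m :: nat assume nm: "n \<le> m"
      show "g n * f m \<le> g m * f n"
      proof (cases "(f n > 0 \<or> g n > 0) \<and> (f m > 0 \<or> g m > 0)")
        case True
        with L nm have "g n / f n \<le> g m / f m"
          by (auto simp: mono_on_def)
        with True show ?thesis using key by blast
      qed (auto simp: zero_less_iff_neq_zero)
    qed
  next
    assume "\<forall>n m. n \<le> m \<longrightarrow> g n * f m \<le> g m * f n"
    then show "mono_on {n. f n > 0 \<or> g n > 0} (\<lambda>n. g n / f n)"
      using key by (auto simp: mono_on_def)
  qed
qed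

end

theory Submission
  imports Defs
begin

text \<open>
  Write $q = 1 - p$. The probability of a path of length $n$ with $u$ up-steps is $p^u q^{n-u}$, and
  the set of paths leaving the symmetric region for the first time at time $n$ is closed under
  reflection. Averaging a path with its mirror image, which ends at distance $k$ from the origin as
  well, therefore gives
  \[ 2\, P(T^p = n) = \sum_{\mbox{\scriptsize exit paths}} (pq)^c\,(p^k + q^k), \qquad 2c + k = n, \]
  (\<open>exit_prob_symmetrised\<close>, \<open>path_weight_symmetrised\<close>). In this form the parameter enters only
  through $s = pq$, because $p^k + q^k$ is the Lucas-type polynomial in $s$ generated by
  $L_{k+2} = L_{k+1} - s L_k$. Hence $p \le p' \le 1/2$ and $p \ge p' \ge 1/2$ are the same
  situation, namely $s \le s'$, and both halves of the theorem follow from \<open>lr_le_exit_time\<close>.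

  The order follows term by term. Take an exit path of length $n$ ending at distance $k$ and an exit
  path of length $m > n$ ending at distance $l$. The first one is outside the barrier, so
  $k \ge b_n$. The second one is strictly inside $b_{m-1}$ one step before it ends, so
  $l \le b_{m-1} \le b_n \le k$; this is where the monotonicity of the barrier enters. Then the
  exponent of $s$ is larger for the longer path, and passing from $s$ to $s'$ favours it; and so
  does the remaining factor, since $L_k / L_l$ is non-increasing in $s$ for $l \le k$
  (\<open>power_sum_ratio\<close>, by induction from the recurrence). This is \<open>exit_path_weights_cross\<close>, and
  summing over all pairs of paths gives the cross-multiplied form of the order (\<open>exit_prob_cross\<close>).

  The order also requires $T^p$ to be almost surely finite: among infinitely many disjoint blocks of
  $2 b_1 + 1$ steps, almost surely one consists of equal steps, and such a block carries the walk
  beyond $b_1$ at one of its two ends (\<open>AE_exit_time_finite\<close>).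
\<close>

section \<open>Power sums of $p$ and $1 - p$\<close>

definition power_sum :: "nat \<Rightarrow> real \<Rightarrow> real" where
  "power_sum k p = p ^ k + (1 - p) ^ k"

lemma power_sum_pos: "0 \<le> p \<Longrightarrow> p \<le> 1 \<Longrightarrow> power_sum k p > 0"
  by (cases "p = 0") (auto simp: power_sum_def power_0_left intro!: add_pos_nonneg)

lemma power_sum_recurrence:
  "power_sum (Suc (Suc k)) p = power_sum (Suc k) p - p * (1 - p) * power_sum k p"
  by (simp add: power_sum_def algebra_simps)

text \<open>
  The ratio $r_k = L_{k+1}/L_k$ satisfies $r_{k+1} = 1 - s/r_k$ and $r_0 = 1/2$, so it is
  non-increasing in $s = p(1-p)$ by induction on $k$. Cross-multiplied, the induction step is the product of the
  induction hypothesis with $s \le s'$.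
\<close>

lemma power_sum_consecutive_ratio:
  assumes "0 \<le> p" "p \<le> 1" "0 \<le> p'" "p' \<le> 1" and s: "p * (1 - p) \<le> p' * (1 - p')"
  shows "power_sum (Suc k) p' * power_sum k p \<le> power_sum (Suc k) p * power_sum k p'"
proof (induction k)
  case 0
  show ?case by (simp add: power_sum_def)
next
  case (Suc k)
  have "p * (1 - p) * (power_sum (Suc k) p' * power_sum k p)
      \<le> p' * (1 - p') * (power_sum (Suc k) p * power_sum k p')"
    using assms less_imp_le[OF power_sum_pos]
    by (intro mult_mono[OF s Suc.IH] mult_nonneg_nonneg) auto
  then show ?case
    unfolding power_sum_recurrence by (simp add: algebra_simps)
qed

text \<open>
  The case of consecutive exponents says that $L_j(p')/L_j(p)$ does not increase from $j$ to $j+1$;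
  chaining these steps from $l$ to $k$ gives the general case.
\<close>

lemma power_sum_ratio:
  assumes p: "0 \<le> p" "p \<le> 1" "0 \<le> p'" "p' \<le> 1" "p * (1 - p) \<le> p' * (1 - p')" and "l \<le> k"
  shows "power_sum k p' * power_sum l p \<le> power_sum l p' * power_sum k p"
proof -
  have "power_sum k p' / power_sum k p \<le> power_sum l p' / power_sum l p"
  proof (rule lift_Suc_antimono_le[OF _ \<open>l \<le> k\<close>])
    show "power_sum (Suc j) p' / power_sum (Suc j) p \<le> power_sum j p' / power_sum j p" for j
      using power_sum_consecutive_ratio[OF p, of j] power_sum_pos[OF p(1,2)]
      by (simp add: divide_simps mult_ac less_imp_neq[symmetric] not_less less_imp_le)
  qed
  then show ?thesis
    using power_sum_pos[OF p(1,2)] by (simp add: divide_simps mult_ac less_imp_neq[symmetric] less_imp_le)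
qed

section \<open>Exit paths and their weights\<close>

definition first_exit :: "(nat \<Rightarrow> nat) \<Rightarrow> (nat \<Rightarrow> int) \<Rightarrow> nat \<Rightarrow> bool" where
  "first_exit b x n \<longleftrightarrow>
     1 \<le> n \<and> \<bar>x n\<bar> \<ge> int (b n) \<and> (\<forall>j\<in>{1..<n}. \<bar>x j\<bar> < int (b j))"

text \<open>
  A path of length $n$ is encoded by the set $U \subseteq \{1,\dots,n\}$ of its up-steps; reflection
  in the origin is then complementation.
\<close>

definition path_step :: "nat set \<Rightarrow> nat \<Rightarrow> int" where
  "path_step U i = (if i \<in> U then 1 else - 1)"

definition path_pos :: "nat set \<Rightarrow> nat \<Rightarrow> int" where
  "path_pos U j = (\<Sum>i=1..j. path_step U i)"

definition exit_paths :: "(nat \<Rightarrow> nat) \<Rightarrow> nat \<Rightarrow> nat set set" where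
  "exit_paths b n = {U. U \<subseteq> {1..n} \<and> first_exit b (path_pos U) n}"

definition path_weight :: "nat \<Rightarrow> real \<Rightarrow> nat set \<Rightarrow> real" where
  "path_weight n p U = p ^ card U * (1 - p) ^ (n - card U)"

lemma finite_exit_paths: "finite (exit_paths b n)"
  by (rule finite_subset[of _ "Pow {1..n}"]) (auto simp: exit_paths_def)

lemma path_pos_final:
  assumes "U \<subseteq> {1..n}"
  shows "path_pos U n = 2 * int (card U) - int n"
proof -
  have "path_pos U n = int (card ({1..n} \<inter> U)) - int (card ({1..n} - U))"
    by (simp add: path_pos_def path_step_def sum.If_cases Diff_eq Collect_neg_eq)
  moreover have "{1..n} \<inter> U = U" "card ({1..n} - U) = n - card U" "card U \<le> n"
    using assms card_mono[OF _ assms] by (auto simp: card_Diff_subset finite_subset)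
  ultimately show ?thesis by simp
qed

lemma path_pos_complement:
  assumes "j \<le> n"
  shows "path_pos ({1..n} - U) j = - path_pos U j"
  unfolding path_pos_def sum_negf[symmetric]
  using assms by (intro sum.cong) (auto simp: path_step_def)

lemma complement_exit_path:
  "U \<in> exit_paths b n \<Longrightarrow> {1..n} - U \<in> exit_paths b n"
  by (auto simp: exit_paths_def first_exit_def path_pos_complement simp del: One_nat_def)

lemma path_weight_complement:
  assumes "U \<subseteq> {1..n}"
  shows "path_weight n p ({1..n} - U) = path_weight n (1 - p) U"
  using assms card_mono[OF _ assms] by (simp add: path_weight_def card_Diff_subset finite_subset)

text \<open>
  If $u$ and $d$ are the numbers of up- and down-steps, then $c = \min(u,d)$ pairs of opposite steps
  cancel and the remaining $k = |u - d|$ steps all have the same sign. The number $c$ is obtained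
  before $p$ is chosen, as the comparison of two parameters needs a common exponent.
\<close>

lemma path_weight_symmetrised:
  assumes U: "U \<subseteq> {1..n}"
  obtains c where "2 * c + nat \<bar>path_pos U n\<bar> = n"
    and "\<And>p. path_weight n p U + path_weight n (1 - p) U
           = (p * (1 - p)) ^ c * power_sum (nat \<bar>path_pos U n\<bar>) p"
proof -
  define u d where "u = card U" and "d = n - card U"
  have n: "n = u + d" using card_mono[OF _ U] by (simp add: u_def d_def)
  have pos: "path_pos U n = int u - int d"
    using path_pos_final[OF U] n u_def by simp
  define c k where "c = min u d" and "k = nat \<bar>path_pos U n\<bar>"
  have ud: "u = c \<and> d = c + k \<or> u = c + k \<and> d = c"
    using pos by (auto simp: c_def k_def)
  show thesis
  proof (rule that[of c]; fold k_def)
    show "2 * c + k = n" using ud n by auto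
    show "path_weight n p U + path_weight n (1 - p) U = (p * (1 - p)) ^ c * power_sum k p" for p
    proof -
      have weight: "path_weight n q U = q ^ u * (1 - q) ^ d" for q
        by (simp add: path_weight_def u_def d_def)
      show ?thesis
        unfolding weight power_sum_def power_mult_distrib using ud
        by (auto simp: power_add distrib_left mult_ac)
    qed
  qed
qed

text \<open>
  One step earlier the path was strictly inside the barrier, so it overshoots by at most the
  difference between the two barrier heights. The first step has no such predecessor, hence
  $m \ge 1$.
\<close>

lemma exit_path_pos_le:
  assumes "U \<in> exit_paths b (Suc m)" "1 \<le> m"
  shows "nat \<bar>path_pos U (Suc m)\<bar> \<le> b m"
proof -
  have "path_pos U (Suc m) = path_pos U m + path_step U (Suc m)"
    by (simp add: path_pos_def)
  moreover have "\<bar>path_step U (Suc m)\<bar> = 1" by (simp add: path_step_def)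
  moreover have "\<bar>path_pos U m\<bar> < int (b m)"
    using assms by (auto simp: exit_paths_def first_exit_def)
  ultimately show ?thesis by linarith
qed

text \<open>
  The decreasing barrier forces the later exit to be the one closer to the origin, so that both
  factors $s^{e-c}$ and $L_l/L_k$ of the ratio of the two symmetrised weights are non-decreasing in $s$.
\<close>

lemma exit_path_weights_cross:
  assumes b: "antimono_on {1..} b"
    and p: "0 \<le> p" "p \<le> 1" "0 \<le> p'" "p' \<le> 1" "p * (1 - p) \<le> p' * (1 - p')"
    and "n < m" and U: "U \<in> exit_paths b n" and V: "V \<in> exit_paths b m"
  shows "(path_weight n p' U + path_weight n (1 - p') U) * (path_weight m p V + path_weight m (1 - p) V)
    \<le> (path_weight m p' V + path_weight m (1 - p') V) * (path_weight n p U + path_weight n (1 - p) U)"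
proof -
  have "1 \<le> n" using U by (auto simp: exit_paths_def first_exit_def)
  obtain m' where m': "m = Suc m'" "n \<le> m'" using \<open>n < m\<close> by (cases m) auto
  define k l where "k = nat \<bar>path_pos U n\<bar>" and "l = nat \<bar>path_pos V m\<bar>"
  have "l \<le> b m'" using exit_path_pos_le V m' \<open>1 \<le> n\<close> by (simp add: l_def)
  also have "\<dots> \<le> b n" by (rule monotone_onD[OF b]) (use \<open>1 \<le> n\<close> m'(2) in auto)
  also have "\<dots> \<le> k" using U by (auto simp: exit_paths_def first_exit_def k_def)
  finally have "l \<le> k" .
  obtain c where c: "2 * c + k = n"
    "\<And>p. path_weight n p U + path_weight n (1 - p) U = (p * (1 - p)) ^ c * power_sum k p"
    using path_weight_symmetrised[of U n] U by (auto simp: exit_paths_def k_def)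
  obtain e where e: "2 * e + l = m"
    "\<And>p. path_weight m p V + path_weight m (1 - p) V = (p * (1 - p)) ^ e * power_sum l p"
    using path_weight_symmetrised[of V m] V by (auto simp: exit_paths_def l_def)
  obtain f where f: "e = c + f"
    using c(1) e(1) \<open>l \<le> k\<close> \<open>n < m\<close> le_Suc_ex[of c e] by auto
  define s s' where "s = p * (1 - p)" and "s' = p' * (1 - p')"
  have s: "0 \<le> s" "s \<le> s'" using p by (auto simp: s_def s'_def)
  have "s' ^ c * s ^ c * (s ^ f * (power_sum k p' * power_sum l p))
      \<le> s' ^ c * s ^ c * (s' ^ f * (power_sum l p' * power_sum k p))"
    using s p less_imp_le[OF power_sum_pos]
    by (intro mult_left_mono mult_mono power_mono power_sum_ratio[OF p \<open>l \<le> k\<close>] mult_nonneg_nonneg)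
       auto
  then show ?thesis
    unfolding c(2) e(2) by (simp add: f power_add mult_ac flip: s_def s'_def)
qed

section \<open>Cross inequality for exit probabilities\<close>

definition exit_prob :: "(nat \<Rightarrow> nat) \<Rightarrow> nat \<Rightarrow> real \<Rightarrow> real" where
  "exit_prob b n p = (\<Sum>U\<in>exit_paths b n. path_weight n p U)"

lemma exit_prob_symmetrised:
  "2 * exit_prob b n p = (\<Sum>U\<in>exit_paths b n. path_weight n p U + path_weight n (1 - p) U)"
proof -
  have "exit_prob b n p = (\<Sum>U\<in>exit_paths b n. path_weight n (1 - p) U)"
    unfolding exit_prob_def
    by (rule sum.reindex_bij_witness[of _ "\<lambda>U. {1..n} - U" "\<lambda>U. {1..n} - U"])
       (use complement_exit_path in
         \<open>auto simp: exit_paths_def path_weight_complement double_diff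
           simp del: One_nat_def\<close>)
  then show ?thesis by (simp add: sum.distrib) (simp add: exit_prob_def)
qed

lemma exit_prob_cross:
  assumes b: "antimono_on {1..} b"
    and p: "0 \<le> p" "p \<le> 1" "0 \<le> p'" "p' \<le> 1" "p * (1 - p) \<le> p' * (1 - p')"
    and "n \<le> m"
  shows "exit_prob b n p' * exit_prob b m p \<le> exit_prob b m p' * exit_prob b n p"
proof (cases "n = m")
  case False
  then have "n < m" using \<open>n \<le> m\<close> by simp
  have "(2 * exit_prob b n p') * (2 * exit_prob b m p)
      \<le> (2 * exit_prob b n p) * (2 * exit_prob b m p')"
    unfolding exit_prob_symmetrised sum_product
    using exit_path_weights_cross[OF b p \<open>n < m\<close>] by (intro sum_mono) (simp add: mult.commute)
  then show ?thesis by (simp add: mult_ac)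
qed simp

lemma exit_prob_nonneg: "0 \<le> p \<Longrightarrow> p \<le> 1 \<Longrightarrow> 0 \<le> exit_prob b n p"
  by (auto simp: exit_prob_def path_weight_def intro!: sum_nonneg)

section \<open>Law of the exit time\<close>

lemma exit_time_eq_enat_iff:
  "exit_time b X \<omega> = enat n \<longleftrightarrow> first_exit b (\<lambda>j. walk X j \<omega>) n"
proof -
  define P where "P n \<longleftrightarrow> 1 \<le> n \<and> \<bar>walk X n \<omega>\<bar> \<ge> int (b n)" for n
  have T: "exit_time b X \<omega> = Inf {enat n |n. P n}" by (simp add: exit_time_def P_def)
  have "exit_time b X \<omega> = enat n \<longleftrightarrow> P n \<and> (\<forall>j<n. \<not> P j)"
  proof
    assume *: "exit_time b X \<omega> = enat n"
    then have ne: "{enat n |n. P n} \<noteq> {}" unfolding T Inf_enat_def by (auto split: if_splits)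
    have "Inf {enat n |n. P n} \<in> {enat n |n. P n}" using ne by (meson ex_in_conv wellorder_InfI)
    then have "enat n \<in> {enat n |n. P n}"
      using * unfolding T by simp
    moreover have "\<not> P j" if "j < n" for j
      using that Inf_lower[of "enat j" "{enat n |n. P n}"] * unfolding T by auto
    ultimately show "P n \<and> (\<forall>j<n. \<not> P j)" by auto
  next
    assume "P n \<and> (\<forall>j<n. \<not> P j)"
    then show "exit_time b X \<omega> = enat n"
      unfolding T by (intro antisym Inf_lower Inf_greatest) (auto simp: not_less[symmetric])
  qed
  also have "\<dots> \<longleftrightarrow> first_exit b (\<lambda>j. walk X j \<omega>) n"
    unfolding P_def first_exit_def by (auto simp: not_le[symmetric])
  finally show ?thesis .
qed

lemma exit_time_finite_iff:
  "exit_time b X \<omega> < \<infinity> \<longleftrightarrow> (\<exists>n\<ge>1. \<bar>walk X n \<omega>\<bar> \<ge> int (b n))"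
  unfolding exit_time_def Inf_less_iff by auto

lemma exit_time_ge_1: "1 \<le> exit_time b X \<omega>"
  unfolding exit_time_def by (auto intro!: Inf_greatest simp: one_enat_def)

lemma bernoulli_steps_measurable:
  assumes "bernoulli_steps M p X" "1 \<le> i"
  shows "X i \<in> measurable M (count_space UNIV)"
proof -
  interpret prob_space M using assms by (simp add: bernoulli_steps_def)
  show ?thesis using assms by (simp add: bernoulli_steps_def indep_vars_def)
qed

text \<open>
  The integers carry the discrete \<open>\<sigma>\<close>-algebra here; as they are countable, the sum of two
  measurable functions can be handled by fixing the value of the first.
\<close>

lemma walk_measurable:
  assumes "bernoulli_steps M p X"
  shows "walk X n \<in> measurable M (count_space UNIV)"
proof (induction n)
  case 0
  have "walk X 0 = (\<lambda>_. 0)" by (simp add: walk_def fun_eq_iff)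
  then show ?case by simp
next
  case (Suc n)
  have "(\<lambda>\<omega>. z + X (Suc n) \<omega>) \<in> measurable M (count_space UNIV)" for z
    by (rule measurable_compose[OF bernoulli_steps_measurable[OF assms]]) simp_all
  then have "(\<lambda>\<omega>. walk X n \<omega> + X (Suc n) \<omega>) \<in> measurable M (count_space UNIV)"
    by (rule measurable_compose_countable[OF _ Suc.IH])
  moreover have "walk X (Suc n) = (\<lambda>\<omega>. walk X n \<omega> + X (Suc n) \<omega>)"
    by (simp add: walk_def fun_eq_iff)
  ultimately show ?case by simp
qed

lemma exit_time_level_set:
  assumes "bernoulli_steps M p X"
  shows "{\<omega> \<in> space M. exit_time b X \<omega> = enat n} \<in> sets M"
proof -
  have level: "{\<omega> \<in> space M. \<bar>walk X j \<omega>\<bar> \<ge> int (b j)} \<in> sets M" for j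
    using measurable_sets[OF walk_measurable[OF assms, of j], of "{z. \<bar>z\<bar> \<ge> int (b j)}"]
    by (simp add: vimage_def Int_def conj_commute)
  have "{\<omega> \<in> space M. exit_time b X \<omega> = enat n} =
      (if 1 \<le> n then {\<omega> \<in> space M. \<bar>walk X n \<omega>\<bar> \<ge> int (b n)} -
        (\<Union>j\<in>{1..<n}. {\<omega> \<in> space M. \<bar>walk X j \<omega>\<bar> \<ge> int (b j)}) else {})"
    unfolding exit_time_eq_enat_iff first_exit_def by (auto simp: not_le)
  also have "\<dots> \<in> sets M" using level by (auto intro!: sets.Diff sets.finite_UN)
  finally show ?thesis .
qed

text \<open>
  Up to a null set on which some step is not $\pm 1$, the event that the exit happens at time $n$ is
  the disjoint union, over the exit paths, of the events that the walk follows the path.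
\<close>

lemma prob_at_exit_time:
  assumes "bernoulli_steps M p X"
  shows "prob_at M (exit_time b X) n = ennreal (exit_prob b n p)"
proof -
  interpret prob_space M using assms by (simp add: bernoulli_steps_def)
  have indep: "indep_vars (\<lambda>_. count_space UNIV) X {1..}"
    and P: "\<And>i. 1 \<le> i \<Longrightarrow> prob {\<omega> \<in> space M. X i \<omega> = 1} = p"
      "\<And>i. 1 \<le> i \<Longrightarrow> prob {\<omega> \<in> space M. X i \<omega> = - 1} = 1 - p"
    using assms by (auto simp: bernoulli_steps_def)
  have X [measurable]: "X i \<in> measurable M (count_space UNIV)" if "1 \<le> i" for i
    by (rule bernoulli_steps_measurable[OF assms(1) that])
  \<comment> \<open>the event that the first \<open>n\<close> steps are those of the path \<open>U\<close>\<close>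
  define cyl where "cyl U = {\<omega> \<in> space M. \<forall>i\<in>{1..n}. X i \<omega> = path_step U i}" for U
  have cyl_events: "cyl U \<in> events" for U
    unfolding cyl_def by measurable
  have cyl_prob: "prob (cyl U) = path_weight n p U" if U: "U \<subseteq> {1..n}" for U
  proof (cases "n = 0")
    case True
    with U show ?thesis by (simp add: cyl_def path_weight_def prob_space)
  next
    case False
    have "cyl U = (\<Inter>i\<in>{1..n}. X i -` {path_step U i} \<inter> space M)"
      using False by (auto simp: cyl_def)
    also have "prob \<dots> = (\<Prod>i\<in>{1..n}. prob (X i -` {path_step U i} \<inter> space M))"
      using False by (intro indep_varsD[OF indep]) auto
    also have "\<dots> = (\<Prod>i\<in>{1..n}. if i \<in> U then p else 1 - p)"
    proof (intro prod.cong refl)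
      fix i assume "i \<in> {1..n}"
      moreover have "X i -` {path_step U i} \<inter> space M = {\<omega> \<in> space M. X i \<omega> = path_step U i}"
        by auto
      ultimately show "prob (X i -` {path_step U i} \<inter> space M) = (if i \<in> U then p else 1 - p)"
        using P[of i] by (simp add: path_step_def)
    qed
    also have "\<dots> = p ^ card ({1..n} \<inter> U) * (1 - p) ^ card ({1..n} - U)"
      by (simp add: prod.If_cases Diff_eq Collect_neg_eq)
    also have "{1..n} \<inter> U = U" using U by auto
    also have "card ({1..n} - U) = n - card U"
      using U by (simp add: card_Diff_subset finite_subset)
    finally show ?thesis by (simp add: path_weight_def)
  qed
  have pm1: "AE \<omega> in M. X i \<omega> = 1 \<or> X i \<omega> = - 1" if i: "1 \<le> i" for i
  proof -
    have "prob ({\<omega> \<in> space M. X i \<omega> = 1} \<union> {\<omega> \<in> space M. X i \<omega> = - 1}) = 1"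
      using P[OF i] i by (subst finite_measure_Union) auto
    then show ?thesis
      by (subst (asm) prob_eq_1) (use i in auto)
  qed
  have "AE \<omega> in M. \<forall>i\<in>{1..n}. X i \<omega> = 1 \<or> X i \<omega> = - 1"
    using pm1 by (intro AE_ball_countable[THEN iffD2]) auto
  then have AE_iff: "AE \<omega> in M. \<omega> \<in> {\<omega> \<in> space M. exit_time b X \<omega> = enat n} \<longleftrightarrow>
      \<omega> \<in> (\<Union>U\<in>exit_paths b n. cyl U)"
    using AE_space
  proof eventually_elim
    fix \<omega> assume pm: "\<forall>i\<in>{1..n}. X i \<omega> = 1 \<or> X i \<omega> = - 1" and "\<omega> \<in> space M"
    have walk: "first_exit b (\<lambda>j. walk X j \<omega>) n \<longleftrightarrow> first_exit b (path_pos U) n"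
      if "\<omega> \<in> cyl U" for U
    proof -
      have "walk X j \<omega> = path_pos U j" if "j \<le> n" for j
        using that \<open>\<omega> \<in> cyl U\<close> by (auto simp: walk_def path_pos_def cyl_def intro!: sum.cong)
      then show ?thesis by (simp add: first_exit_def)
    qed
    define U where "U = {i \<in> {1..n}. X i \<omega> = 1}"
    have "\<omega> \<in> cyl U" using pm \<open>\<omega> \<in> space M\<close> by (auto simp: cyl_def U_def path_step_def)
    moreover have "U \<subseteq> {1..n}" by (auto simp: U_def)
    ultimately show "\<omega> \<in> {\<omega> \<in> space M. exit_time b X \<omega> = enat n} \<longleftrightarrow>
      \<omega> \<in> (\<Union>U\<in>exit_paths b n. cyl U)"
      using walk \<open>\<omega> \<in> space M\<close>
      unfolding exit_time_eq_enat_iff exit_paths_def by blast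
  qed
  have events: "{\<omega> \<in> space M. exit_time b X \<omega> = enat n} \<in> events"
    by (rule exit_time_level_set[OF assms(1)])
  have "prob {\<omega> \<in> space M. exit_time b X \<omega> = enat n} = prob (\<Union>U\<in>exit_paths b n. cyl U)"
    using events cyl_events finite_exit_paths
    by (intro finite_measure_eq_AE[OF AE_iff]) auto
  also have "\<dots> = (\<Sum>U\<in>exit_paths b n. prob (cyl U))"
  proof (rule finite_measure_finite_Union[OF finite_exit_paths])
    show "disjoint_family_on cyl (exit_paths b n)"
      unfolding disjoint_family_on_def
    proof (intro ballI impI)
      fix U V assume UV: "U \<in> exit_paths b n" "V \<in> exit_paths b n" "U \<noteq> V"
      have "U = V" if "\<omega> \<in> cyl U" "\<omega> \<in> cyl V" for \<omega>
      proof -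
        have "i \<in> U \<longleftrightarrow> i \<in> V" if "i \<in> {1..n}" for i
        proof -
          have "path_step U i = path_step V i"
            using \<open>\<omega> \<in> cyl U\<close> \<open>\<omega> \<in> cyl V\<close> that by (auto simp: cyl_def)
          then show ?thesis by (auto simp: path_step_def split: if_splits)
        qed
        then show ?thesis using UV(1,2) by (auto simp: exit_paths_def)
      qed
      then show "cyl U \<inter> cyl V = {}" using UV(3) by auto
    qed
  qed (use cyl_events in auto)
  also have "\<dots> = exit_prob b n p"
    by (simp add: exit_prob_def cyl_prob exit_paths_def)
  finally show ?thesis by (simp add: prob_at_def emeasure_eq_measure)
qed

section \<open>Almost sure finiteness\<close>

text \<open>
  Fix a sign \<open>\<sigma>\<close> that a step takes with positive probability $r$, and cut the time axis into blocks
  of length $K = 2 b_1 + 1$. A block with all steps equal to \<open>\<sigma>\<close> moves the walk by $K$, so the walk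
  cannot be within distance $b_1$ of the origin both before and after it. The blocks are independent,
  so the first $J$ of them all fail with probability $(1 - r^K)^J$, which tends to $0$.
\<close>

lemma AE_exit_time_finite:
  assumes "bernoulli_steps M p X" "0 \<le> p" "p \<le> 1" and b: "antimono_on {1..} b"
  shows "AE \<omega> in M. exit_time b X \<omega> < \<infinity>"
proof -
  interpret prob_space M using assms by (simp add: bernoulli_steps_def)
  have indep: "indep_vars (\<lambda>_. count_space UNIV) X {1..}"
    and P: "\<And>i. 1 \<le> i \<Longrightarrow> prob {\<omega> \<in> space M. X i \<omega> = 1} = p"
      "\<And>i. 1 \<le> i \<Longrightarrow> prob {\<omega> \<in> space M. X i \<omega> = - 1} = 1 - p"
    using assms by (auto simp: bernoulli_steps_def)
  have X [measurable]: "X i \<in> measurable M (count_space UNIV)" if "1 \<le> i" for i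
    by (rule bernoulli_steps_measurable[OF assms(1) that])
  obtain \<sigma> :: int and r where \<sigma>: "\<bar>\<sigma>\<bar> = 1" and r: "0 < r" "r \<le> 1"
    and Pr: "\<And>i. 1 \<le> i \<Longrightarrow> prob {\<omega> \<in> space M. X i \<omega> = \<sigma>} = r"
  proof (cases "p = 0")
    case True
    with P(2) that[of "- 1" 1] show ?thesis by simp
  next
    case False
    with P(1) that[of 1 p] assms show ?thesis by simp
  qed
  define K where "K = Suc (2 * b 1)"
  define B where "B j = {j * K + 1..j * K + K}" for j
  define E where "E j f \<longleftrightarrow> (\<forall>i\<in>B j. f i = \<sigma>)" for j and f :: "nat \<Rightarrow> int"
  have disj: "disjoint_family_on B UNIV"
    unfolding disjoint_family_on_def
  proof (intro ballI impI)
    fix i j :: nat assume "i \<noteq> j"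
    moreover have "B i \<inter> B j = {}" if "i < j" for i j
    proof -
      have "Suc i * K \<le> j * K" using that by (intro mult_le_mono1) simp
      then show ?thesis by (auto simp: B_def)
    qed
    ultimately show "B i \<inter> B j = {}" by (metis inf_commute nat_neq_iff)
  qed
  have "indep_vars (\<lambda>j. PiM (B j) (\<lambda>_. count_space UNIV)) (\<lambda>j \<omega>. restrict (\<lambda>i. X i \<omega>) (B j)) UNIV"
    by (rule indep_vars_restrict[OF indep _ disj]) (auto simp: B_def)
  moreover have "E j \<in> measurable (PiM (B j) (\<lambda>_. count_space UNIV)) (count_space UNIV)" for j
  proof -
    have "finite (B j)" by (simp add: B_def)
    then show ?thesis unfolding E_def by measurable
  qed
  ultimately have "indep_vars (\<lambda>_. count_space UNIV)
      (\<lambda>j \<omega>. E j (restrict (\<lambda>i. X i \<omega>) (B j))) UNIV"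
    by (rule indep_vars_compose2)
  then have indep_E: "indep_vars (\<lambda>_. count_space UNIV) (\<lambda>j \<omega>. E j (\<lambda>i. X i \<omega>)) UNIV"
    by (simp add: E_def)
  have E_events: "{\<omega> \<in> space M. E j (\<lambda>i. X i \<omega>)} \<in> events" for j
    unfolding E_def B_def by measurable
  have E_prob: "prob {\<omega> \<in> space M. E j (\<lambda>i. X i \<omega>)} = r ^ K" for j
  proof -
    have "{\<omega> \<in> space M. E j (\<lambda>i. X i \<omega>)} = (\<Inter>i\<in>B j. X i -` {\<sigma>} \<inter> space M)"
      by (auto simp: E_def B_def K_def)
    also have "prob \<dots> = (\<Prod>i\<in>B j. prob (X i -` {\<sigma>} \<inter> space M))"
      by (intro indep_varsD[OF indep]) (auto simp: B_def K_def)
    also have "\<dots> = (\<Prod>i\<in>B j. r)"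
    proof (intro prod.cong refl)
      fix i assume "i \<in> B j"
      then show "prob (X i -` {\<sigma>} \<inter> space M) = r"
        using Pr[of i] by (simp add: B_def vimage_def Int_def conj_commute)
    qed
    finally show ?thesis by (simp add: B_def)
  qed
  have E_exit: "exit_time b X \<omega> < \<infinity>" if "E j (\<lambda>i. X i \<omega>)" for j \<omega>
  proof -
    have "walk X (j * K + K) \<omega> = walk X (j * K) \<omega> + (\<Sum>i\<in>B j. X i \<omega>)"
      unfolding walk_def B_def
      by (subst sum.union_disjoint[symmetric]) (auto intro!: sum.cong)
    also have "(\<Sum>i\<in>B j. X i \<omega>) = int K * \<sigma>"
      using that by (simp add: E_def B_def)
    finally have walk: "walk X (j * K + K) \<omega> = walk X (j * K) \<omega> + int K * \<sigma>" .
    have "\<bar>int K * \<sigma>\<bar> = int (Suc (2 * b 1))" using \<sigma> by (simp add: abs_mult K_def)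
    with walk have or: "int (b 1) < \<bar>walk X (j * K + K) \<omega>\<bar> \<or> int (b 1) < \<bar>walk X (j * K) \<omega>\<bar>"
      by linarith
    \<comment> \<open>the walk starts at \<open>0\<close>, so an end of the block beyond \<open>b 1\<close> has a positive time\<close>
    obtain n where n: "int (b 1) < \<bar>walk X n \<omega>\<bar>" using or by blast
    then have "1 \<le> n" by (cases n) (auto simp: walk_def)
    then have "b n \<le> b 1" by (intro monotone_onD[OF b]) auto
    with n \<open>1 \<le> n\<close> show ?thesis
      unfolding exit_time_finite_iff by (intro exI[of _ n]) linarith
  qed
  \<comment> \<open>the event that none of the first \<open>J\<close> blocks is constantly \<open>\<sigma>\<close>\<close>
  define N where "N J = {\<omega> \<in> space M. \<forall>j<J. \<not> E j (\<lambda>i. X i \<omega>)}" for J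
  have N_events: "N J \<in> events" for J
  proof -
    have "N J = space M - (\<Union>j\<in>{..<J}. {\<omega> \<in> space M. E j (\<lambda>i. X i \<omega>)})"
      by (auto simp: N_def)
    then show ?thesis using E_events by auto
  qed
  have N_prob: "prob (N J) = (1 - r ^ K) ^ J" for J
  proof (cases "J = 0")
    case True
    then show ?thesis by (simp add: N_def prob_space)
  next
    case False
    have "N J = (\<Inter>j\<in>{..<J}. (\<lambda>\<omega>. E j (\<lambda>i. X i \<omega>)) -` {False} \<inter> space M)"
      using False by (auto simp: N_def)
    also have "prob \<dots> = (\<Prod>j\<in>{..<J}. prob ((\<lambda>\<omega>. E j (\<lambda>i. X i \<omega>)) -` {False} \<inter> space M))"
      using False by (intro indep_varsD[OF indep_E]) auto
    also have "\<dots> = (\<Prod>j\<in>{..<J}. 1 - r ^ K)"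
    proof (intro prod.cong refl)
      fix j
      have "(\<lambda>\<omega>. E j (\<lambda>i. X i \<omega>)) -` {False} \<inter> space M = space M - {\<omega> \<in> space M. E j (\<lambda>i. X i \<omega>)}"
        by auto
      then show "prob ((\<lambda>\<omega>. E j (\<lambda>i. X i \<omega>)) -` {False} \<inter> space M) = 1 - r ^ K"
        using prob_compl[OF E_events] E_prob by simp
    qed
    finally show ?thesis by simp
  qed
  have "(\<lambda>J. prob (N J)) \<longlonglongrightarrow> 0"
    unfolding N_prob using r by (intro LIMSEQ_power_zero) (auto simp: power_le_one)
  moreover have "prob (\<Inter>J. N J) \<le> prob (N J)" for J
    using N_events by (intro finite_measure_mono) auto
  ultimately have "prob (\<Inter>J. N J) \<le> 0"
    by (intro LIMSEQ_le_const) auto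
  then have "(\<Inter>J. N J) \<in> null_sets M"
    using N_events by (auto simp: null_sets_def emeasure_eq_measure intro: antisym)
  then show ?thesis
  proof (rule AE_I')
    show "{\<omega> \<in> space M. \<not> exit_time b X \<omega> < \<infinity>} \<subseteq> (\<Inter>J. N J)"
      using E_exit unfolding N_def by blast
  qed
qed

lemma pos_int_valued_exit_time:
  assumes "bernoulli_steps M p X" "0 \<le> p" "p \<le> 1" and b: "antimono_on {1..} b"
  shows "pos_int_valued M (exit_time b X)"
proof -
  note fin = exit_time_level_set[OF assms(1)]
  have "{\<omega> \<in> space M. exit_time b X \<omega> = \<infinity>} =
      space M - (\<Union>n. {\<omega> \<in> space M. exit_time b X \<omega> = enat n})"
    using not_infinity_eq by blast
  also have "\<dots> \<in> sets M" using fin by blast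
  finally have "{\<omega> \<in> space M. exit_time b X \<omega> = t} \<in> sets M" for t
    by (cases t) (simp_all only: fin)
  then have "exit_time b X \<in> measurable M (count_space UNIV)"
    by (simp add: measurable_count_space_eq2_countable vimage_def Int_def conj_commute)
  then show ?thesis
    using AE_exit_time_finite[OF assms] by (auto simp: pos_int_valued_def exit_time_ge_1)
qed

section \<open>Likelihood ratio order\<close>

text \<open>
  The variance of a step is $4p(1-p)$: the more variable the steps are, the later the exit. The
  hypothesis on $p(1-p)$ covers both sides of $1/2$ at once.
\<close>

lemma lr_le_exit_time:
  assumes X: "bernoulli_steps M p X" and X': "bernoulli_steps M' p' X'"
    and p: "0 \<le> p" "p \<le> 1" "0 \<le> p'" "p' \<le> 1" "p * (1 - p) \<le> p' * (1 - p')"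
    and b: "antimono_on {1..} b"
  shows "lr_le M (exit_time b X) M' (exit_time b X')"
proof -
  have "ennreal (exit_prob b n p') * ennreal (exit_prob b m p)
      \<le> ennreal (exit_prob b m p') * ennreal (exit_prob b n p)" if "n \<le> m" for n m
    using exit_prob_cross[OF b p that] p
    by (simp add: ennreal_mult[symmetric] exit_prob_nonneg ennreal_leI)
  then have "mono_on {n. prob_at M (exit_time b X) n > 0 \<or> prob_at M' (exit_time b X') n > 0}
      (\<lambda>n. prob_at M' (exit_time b X') n / prob_at M (exit_time b X) n)"
    unfolding prob_at_exit_time[OF X] prob_at_exit_time[OF X']
    by (intro iffD2[OF mono_on_ratio_iff_cross_mult] allI impI) simp_all
  then show ?thesis
    unfolding lr_le_def
    using pos_int_valued_exit_time[OF X p(1,2) b] pos_int_valued_exit_time[OF X' p(3,4) b] by blast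
qed

theorem theorem6:
  fixes M :: "real \<Rightarrow> 'a measure" and X :: "real \<Rightarrow> nat \<Rightarrow> 'a \<Rightarrow> int" and b :: "nat \<Rightarrow> nat"
  assumes "\<And>p. p \<in> {0..1} \<Longrightarrow> bernoulli_steps (M p) p (X p)"
    and "\<And>n. n \<ge> 1 \<Longrightarrow> b (Suc n) \<le> b n"
  shows "lr_increasing_on {0..1/2} M (\<lambda>p. exit_time b (X p)) \<and>
         lr_decreasing_on {1/2..1} M (\<lambda>p. exit_time b (X p))"
proof -
  have b: "antimono_on {1..} b"
  proof (rule monotone_onI)
    fix n m :: nat assume "n \<in> {1..}" "n \<le> m"
    from this(2,1) show "b m \<le> b n"
      by (induction rule: dec_induct) (auto intro: order_trans[OF assms(2)])
  qed
  have le: "lr_le (M p) (exit_time b (X p)) (M p') (exit_time b (X p'))"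
    if "p \<in> {0..1}" "p' \<in> {0..1}" "p * (1 - p) \<le> p' * (1 - p')" for p p'
    using that assms(1) b by (intro lr_le_exit_time[where p = p and p' = p']) auto
  have variance_diff: "p' * (1 - p') - p * (1 - p) = (p' - p) * (1 - p - p')" for p p' :: real
    by (simp add: algebra_simps)
  show ?thesis
    unfolding lr_increasing_on_def lr_decreasing_on_def
  proof (intro conjI ballI impI le)
    fix p p' :: real assume "p \<in> {0..1/2}" "p' \<in> {0..1/2}" "p < p'"
    then have "0 \<le> (p' - p) * (1 - p - p')" by (intro mult_nonneg_nonneg) auto
    then show "p * (1 - p) \<le> p' * (1 - p')" using variance_diff[of p' p] by linarith
  next
    fix p p' :: real assume "p \<in> {1/2..1}" "p' \<in> {1/2..1}" "p < p'"
    then have "(p' - p) * (1 - p - p') \<le> 0" by (intro mult_nonneg_nonpos) auto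
    then show "p' * (1 - p') \<le> p * (1 - p)" using variance_diff[of p' p] by linarith
  qed auto
qed

end
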